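(* Let $b\geq 3$ be an integer such that $b+1$ is not a power of $2$, and let $\alpha$ be an integer with $\alpha\neq 0$. Let $q\geq 5$ be a prime. Let $\mathcal{C}_1$ be a $b$-primitive covering system consisting of exactly one congruence for each of the moduli $2^j$ with $1\leq j\leq q$ and $2^jq$ with $0\leq j\leq q$, and let $\mathcal{C}_2$ be a $b$-primitive covering system consisting of exactly one congruence for each of the moduli $2^j3^{i}q^{j'}$ with $0\leq j\leq q$, $1\leq i\leq q$, and $0\leq j'\leq 1$. Let $\mathcal{P}_b(\mathcal{C}_1)$ and $\mathcal{P}_b(\mathcal{C}_2)$ be associated sets of primitive prime divisors, and let $M=\operatorname{lcm}\left(\{2^q,\,3^q,\,b-1,\,q\}\cup\mathcal{P}_b(\mathcal{C}_1)\cup\mathcal{P}_b(\mathcal{C}_2)\right)$. Then there exists an integer $T$ such that for all nonnegative integers $t\equiv T\pmod{M}$ with $(tb^t+\alpha)b+1\geq\max\left(\mathcal{P}_b(\mathcal{C}_1)\cup\mathcal{P}_b(\mathcal{C}_2)\right)$, the number $tb^t+\alpha$ is a $b$-Brier number.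
   Context: Let $b\geq 2$ be an integer. A positive integer $k$ is a $b$-Sierpiński number if $\gcd(k+1,b-1)=1$ and $k\cdot b^n+1$ is composite for all positive integers $n$. A positive integer $k$ is a $b$-Riesel number if $\gcd(k-1,b-1)=1$ and $k\cdot b^n-1$ is composite for all positive integers $n$. A $b$-Brier number is a number that is both $b$-Sierpiński and $b$-Riesel. A covering system (of the integers) is a finite collection of congruences $r_i\pmod{m_i}$, $1\le i\le \nu$, such that every integer $n$ satisfies $n\equiv r_i\pmod{m_i}$ for at least one $i$. For an integer $w\geq 1$, a prime $p$ is a primitive prime divisor of $b^w-1$ if $p\mid b^w-1$ and $p\nmid b^\ell-1$ for all $1\leq \ell<w$. A covering system $\mathcal{C}=\{r_i\pmod{m_i}:1\leq i\leq\nu\}$ is called $b$-primitive if there exist distinct primes $p_1,\ldots,p_\nu$ such that, for each $i$, $p_i$ is a primitive prime divisor of $b^{m_i}-1$. For a $b$-primitive covering system $\mathcal{C}$, $\mathcal{P}_b(\mathcal{C})=\{p_1,\ldots,p_\nu\}$ denotes a (fixed, arbitrary) choice of such primes. *)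

theory Defs
  imports "HOL-Number_Theory.Number_Theory"
begin

definition composite :: "int \<Rightarrow> bool" where
  "composite m \<longleftrightarrow> m > 1 \<and> \<not> prime m"

definition sierpinski :: "int \<Rightarrow> int \<Rightarrow> bool" where
  "sierpinski b k \<longleftrightarrow>
     k > 0 \<and> gcd (k + 1) (b - 1) = 1 \<and> (\<forall>n::nat. n > 0 \<longrightarrow> composite (k * b ^ n + 1))"

definition riesel :: "int \<Rightarrow> int \<Rightarrow> bool" where
  "riesel b k \<longleftrightarrow>
     k > 0 \<and> gcd (k - 1) (b - 1) = 1 \<and> (\<forall>n::nat. n > 0 \<longrightarrow> composite (k * b ^ n - 1))"

definition brier :: "int \<Rightarrow> int \<Rightarrow> bool" where
  "brier b k \<longleftrightarrow> sierpinski b k \<and> riesel b k"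

text \<open>A congruence \<open>r (mod m)\<close> is encoded as the pair \<open>(r, m)\<close>.\<close>

type_synonym congruence = "int \<times> nat"

definition covering_system :: "congruence set \<Rightarrow> bool" where
  "covering_system C \<longleftrightarrow>
     finite C \<and> (\<forall>(r, m)\<in>C. m \<ge> 1) \<and> (\<forall>n::int. \<exists>(r, m)\<in>C. [n = r] (mod int m))"

definition primitive_prime_divisor :: "int \<Rightarrow> nat \<Rightarrow> int \<Rightarrow> bool" where
  "primitive_prime_divisor b w p \<longleftrightarrow>
     w \<ge> 1 \<and> prime p \<and> p dvd b ^ w - 1 \<and> (\<forall>l. 1 \<le> l \<and> l < w \<longrightarrow> \<not> p dvd b ^ l - 1)"

text \<open>\<open>P\<close> is an admissible choice of \<open>\<P>\<^sub>b(C)\<close>: one primitive prime divisor for each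
  congruence of \<open>C\<close>, distinct congruences receiving distinct primes.\<close>

definition associated_primes :: "int \<Rightarrow> congruence set \<Rightarrow> int set \<Rightarrow> bool" where
  "associated_primes b C P \<longleftrightarrow>
     (\<exists>\<pi>. bij_betw \<pi> C P \<and> (\<forall>(r, m)\<in>C. primitive_prime_divisor b m (\<pi> (r, m))))"

definition primitive_covering_system :: "int \<Rightarrow> congruence set \<Rightarrow> bool" where
  "primitive_covering_system b C \<longleftrightarrow> covering_system C \<and> (\<exists>P. associated_primes b C P)"

definition one_congruence_per_modulus :: "congruence set \<Rightarrow> nat set \<Rightarrow> bool" where
  "one_congruence_per_modulus C S \<longleftrightarrow> bij_betw snd C S"

end

(* For t = T (mod M) the residue of t b^t modulo a prime p of P1 or P2 depends only on T, because
   the order of b modulo p divides 2^q 3^q q, which divides M. Prescribing these residues makes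
   every k b^n + 1 divisible by a prime of P1 and every k b^n - 1 divisible by a prime of P2, where
   k = t b^t + alpha; the choice T = -alpha modulo every prime divisor of b - 1 gives the two gcd
   conditions. The size hypothesis still allows k b + 1 or k b - 1 to equal one of these
   primes, but for at most one t. Since T can be chosen in two ways that differ modulo 4, one of
   the two residue classes avoids this t. *)

theory Submission
  imports Defs
begin

section \<open>Residues of \<open>T * b ^ T\<close> modulo finitely many primes\<close>

lemma cong_pow_of_cong_exponent:
  fixes b p :: int and m s t :: nat
  assumes one: "[b ^ m = 1] (mod p)" and st: "[int s = int t] (mod int m)"
  shows "[b ^ s = b ^ t] (mod p)"
proof -
  have "[b ^ i = b ^ j] (mod p)" if "i \<le> j" "[i = j] (mod m)" for i j :: nat
  proof -
    have "m dvd j - i" using that by (simp add: cong_def mod_eq_dvd_iff_nat[symmetric])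
    then obtain d where "j - i = m * d" by (rule dvdE)
    then have d: "j = i + m * d" using that(1) by simp
    have "[b ^ i * (b ^ m) ^ d = b ^ i * 1 ^ d] (mod p)"
      by (intro cong_mult cong_refl cong_pow one)
    then show ?thesis
      by (simp add: d power_add power_mult cong_sym_eq)
  qed
  moreover have "[s = t] (mod m)" using st by (simp only: cong_int_iff)
  ultimately show ?thesis by (cases s t rule: le_cases) (auto intro: cong_sym)
qed

lemma fermat_int:
  fixes b p :: int
  assumes p: "prime p" and "\<not> p dvd b"
  shows "[b ^ nat (p - 1) = 1] (mod p)"
proof -
  obtain n where n: "p = int n"
    using p prime_ge_0_int zero_le_imp_eq_int by blast
  \<comment> \<open>\<open>fermat_theorem\<close> speaks of natural numbers, so \<open>b\<close>,
    which may be negative, is replaced by its least nonnegative residue.\<close>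
  define c where "c = nat (b mod p)"
  have "prime n" using p unfolding n by (rule prime_nat_int_transfer[THEN iffD1])
  then have c: "int c = b mod int n" by (simp add: c_def n prime_gt_0_nat)
  have "\<not> int n dvd int c" using assms(2) by (simp add: c n dvd_mod_iff)
  then have "\<not> n dvd c" unfolding int_dvd_int_iff .
  with \<open>prime n\<close> have "[c ^ (n - 1) = 1] (mod n)" by (rule fermat_theorem)
  then have "[int (c ^ (n - 1)) = int 1] (mod int n)" by (simp only: cong_int_iff)
  then have "[(b mod int n) ^ (n - 1) = 1] (mod int n)" by (simp add: c)
  moreover have "nat (p - 1) = n - 1" by (simp add: n)
  ultimately show ?thesis by (simp add: n cong_def power_mod)
qed

text \<open>The primes are treated in increasing order: the exponent only matters modulo \<open>p - 1\<close>, so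
  the condition at \<open>p\<close> restricts \<open>T\<close> modulo \<open>p\<close> once \<open>T\<close> is known modulo \<open>(p - 1)!\<close>, and
  keeping that residue preserves the conditions at all smaller primes.\<close>

lemma exists_mult_power_residues:
  fixes a b N :: int and c :: "int \<Rightarrow> int"
  assumes "finite P" and "N > 0"
    and P: "\<And>p. p \<in> P \<Longrightarrow> prime p \<and> \<not> p dvd b \<and> \<not> p dvd N"
  shows "\<exists>T::nat. [int T = a] (mod N) \<and> (\<forall>p\<in>P. [int T * b ^ T = c p] (mod p))"
proof -
  \<comment> \<open>By Fermat, \<open>T * b ^ T\<close> modulo \<open>p\<close> is determined by
    \<open>T\<close> modulo \<open>p\<close> and modulo \<open>p - 1\<close>.\<close>
  have cong_transfer: "[int T' * b ^ T' = int T * b ^ T] (mod p)"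
    if "p \<in> P" "[int T' = int T] (mod p)" "[int T' = int T] (mod (p - 1))" for T T' p
  proof -
    have "[b ^ T' = b ^ T] (mod p)"
      using that P prime_gt_0_int[of p]
      by (intro cong_pow_of_cong_exponent[OF fermat_int]) auto
    then show ?thesis using that(2) by (rule cong_mult[rotated])
  qed
  have upto: "\<exists>T::nat. [int T = a] (mod N) \<and> (\<forall>p\<in>P. p \<le> int n \<longrightarrow> [int T * b ^ T = c p] (mod p))"
    for n
  proof (induction n)
    case 0
    have "[int (nat (a mod N)) = a] (mod N)" using \<open>N > 0\<close> by (simp add: cong_def)
    moreover have "\<not> p \<le> int 0" if "p \<in> P" for p using P[OF that] prime_gt_0_int[of p] by simp
    ultimately show ?case by blast
  next
    case (Suc n)
    then obtain T where T: "[int T = a] (mod N)"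
      "\<And>p. p \<in> P \<Longrightarrow> p \<le> int n \<Longrightarrow> [int T * b ^ T = c p] (mod p)" by blast
    show ?case
    proof (cases "int (Suc n) \<in> P")
      case False
      then have "p \<le> int n" if "p \<in> P" "p \<le> int (Suc n)" for p
        using that by (cases "p = int (Suc n)") auto
      then show ?thesis using T by blast
    next
      case True
      define p where "p = int (Suc n)"
      have p: "p \<in> P" "prime p" "\<not> p dvd b" "\<not> p dvd N" "p > 0"
        using True P[of p] by (auto simp: p_def)
      \<comment> \<open>A multiple of \<open>N\<close> and of every \<open>d \<le> n\<close>, in
        particular of \<open>p - 1 = n\<close>, yet prime to \<open>p = n + 1\<close>. Keeping
        \<open>T\<close> modulo \<open>K\<close> preserves everything achieved so far and leaves its
        residue modulo \<open>p\<close> free.\<close>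
      define K where "K = N * fact n"
      have K0: "K > 0" using \<open>N > 0\<close> by (simp add: K_def)
      have "prime (Suc n)" using p(2) unfolding p_def by (rule prime_nat_int_transfer[THEN iffD1])
      then have "\<not> Suc n dvd fact n" using prime_dvd_fact_iff[of "Suc n" n] by simp
      then have "\<not> int (Suc n) dvd int (fact n)" unfolding int_dvd_int_iff .
      then have "\<not> p dvd fact n" unfolding p_def of_nat_fact .
      then have "\<not> p dvd K" using p by (simp add: K_def prime_dvd_mult_iff)
      then have cop: "coprime K p" using prime_imp_coprime[OF p(2)] by (simp only: coprime_commute)
      have "coprime (b ^ T) p" using prime_imp_coprime[OF p(2,3)] by (simp add: coprime_commute)
      \<comment> \<open>Since \<open>T'\<close> will agree with \<open>T\<close> modulo
        \<open>p - 1\<close>, \<open>b ^ T'\<close> is congruent to \<open>b ^ T\<close>, whose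
        inverse \<open>y\<close> is known before \<open>T'\<close> is chosen. The residue
        \<open>c p * y\<close> therefore produces \<open>c p\<close>.\<close>
      then obtain y where y: "[b ^ T * y = 1] (mod p)" using cong_solve_coprime_int by blast
      obtain z where z: "[z = int T] (mod K)" "[z = c p * y] (mod p)"
        using binary_chinese_remainder_int[OF cop] by blast
      \<comment> \<open>Reduction modulo \<open>K * p\<close> gives a nonnegative representative, so
        that it can serve as an exponent.\<close>
      define T' where "T' = nat (z mod (K * p))"
      have "[int T' = z] (mod (K * p))" using K0 p(5) by (simp add: T'_def cong_def)
      then have T': "[int T' = int T] (mod K)" "[int T' = c p * y] (mod p)"
        by (rule cong_trans[OF cong_dvd_modulus z(1)], simp, rule cong_trans[OF cong_dvd_modulus z(2)], simp)
      have small: "[int T' = int T] (mod d)" if "1 \<le> d" "d \<le> int n" for d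
      proof -
        have "nat d dvd fact n" using that by (intro dvd_fact) auto
        then have "int (nat d) dvd int (fact n)" by (simp only: int_dvd_int_iff)
        then have "d dvd fact n" using that by simp
        then have "d dvd K" by (simp add: K_def)
        then show ?thesis using T'(1) by (rule cong_dvd_modulus[rotated])
      qed
      have "[int T' * b ^ T' = c p'] (mod p')" if p': "p' \<in> P" "p' \<le> int n" for p'
      proof -
        have "p' \<ge> 2" using P[OF p'(1)] prime_ge_2_int by blast
        then have "[int T' * b ^ T' = int T * b ^ T] (mod p')"
          using p' by (intro cong_transfer small) auto
        then show ?thesis using T(2)[OF p'] by (rule cong_trans)
      qed
      moreover have "[int T' * b ^ T' = c p] (mod p)"
      proof -
        have "[int T' = int T] (mod int (nat (p - 1)))"
          using small[of "int n"] prime_ge_2_int[OF p(2)] by (simp add: p_def)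
        then have "[b ^ T' = b ^ T] (mod p)"
          by (rule cong_pow_of_cong_exponent[OF fermat_int[OF p(2,3)]])
        then have "[int T' * b ^ T' = c p * y * b ^ T] (mod p)" by (rule cong_mult[OF T'(2)])
        also have "c p * y * b ^ T = c p * (b ^ T * y)" by (simp only: ac_simps)
        also have "[\<dots> = c p * 1] (mod p)" by (intro cong_mult cong_refl y)
        finally show ?thesis by simp
      qed
      moreover have "[int T' = a] (mod N)"
        using cong_dvd_modulus[OF T'(1)] T(1) unfolding K_def by (blast intro: cong_trans dvd_triv_left)
      moreover have "p' \<le> int n \<or> p' = p" if "p' \<le> int (Suc n)" for p'
        using that by (auto simp: p_def)
      ultimately show ?thesis by blast
    qed
  qed
  have "p \<le> int (nat (Max P))" if "p \<in> P" for p
    using Max_ge[OF \<open>finite P\<close> that] by linarith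
  then show ?thesis using upto[of "nat (Max P)"] by blast
qed

section \<open>Covering systems and their primitive prime divisors\<close>

text \<open>If \<open>p\<close> belongs to the congruence r (mod m), then b^n = b^r modulo
  \<open>p\<close> whenever n = r (mod m), so one residue of \<open>k\<close>, namely -s * b^(-r),
  serves all these n. The values s = 1 and s = -1 give the Sierpinski and the Riesel side.\<close>

lemma covering_residues:
  fixes b s :: int
  assumes "covering_system C" and "associated_primes b C P"
  shows "\<exists>c. \<forall>n. \<exists>p\<in>P. \<forall>k. [k = c p] (mod p) \<longrightarrow> p dvd k * b ^ n + s"
proof -
  obtain \<pi> where \<pi>: "bij_betw \<pi> C P"
    and ppd: "\<And>r m. (r, m) \<in> C \<Longrightarrow> primitive_prime_divisor b m (\<pi> (r, m))"
    using assms(2) unfolding associated_primes_def by blast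
  \<comment> \<open>A nonnegative exponent congruent to -r modulo m, so that
    \<open>b ^ e (r, m)\<close> stands for b^(-r).\<close>
  define e where "e = (\<lambda>(r, m). nat (- r mod int m))"
  define c where "c = (\<lambda>p. - s * b ^ e (inv_into C \<pi> p))"
  have "\<exists>p\<in>P. \<forall>k. [k = c p] (mod p) \<longrightarrow> p dvd k * b ^ n + s" for n
  proof -
    obtain r m where rm: "(r, m) \<in> C" "[int n = r] (mod int m)"
      using assms(1) unfolding covering_system_def by blast
    define p where "p = \<pi> (r, m)"
    have "p \<in> P" using \<pi> rm(1) by (auto simp: p_def bij_betw_def)
    have "m \<ge> 1" and pb: "p dvd b ^ m - 1"
      using ppd[OF rm(1)] by (auto simp: p_def primitive_prime_divisor_def)
    have "inv_into C \<pi> p = (r, m)"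
      using \<pi> rm(1) by (auto simp: p_def bij_betw_def)
    then have cp: "c p = - s * b ^ e (r, m)" by (simp add: c_def)
    have "[int (e (r, m)) = - r] (mod int m)"
      using \<open>m \<ge> 1\<close> by (simp add: e_def cong_def)
    then have "[int (e (r, m) + n) = int 0] (mod int m)"
      using cong_add[OF _ rm(2), of "int (e (r, m))" "- r"] by simp
    moreover have "[b ^ m = 1] (mod p)" using pb by (simp add: cong_iff_dvd_diff)
    ultimately have one: "[b ^ (e (r, m) + n) = 1] (mod p)"
      using cong_pow_of_cong_exponent[of b m p "e (r, m) + n" 0] by simp
    have "p dvd k * b ^ n + s" if "[k = c p] (mod p)" for k
    proof -
      have "[k * b ^ n + s = c p * b ^ n + s] (mod p)"
        by (intro cong_add cong_mult that cong_refl)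
      also have "c p * b ^ n + s = - s * b ^ (e (r, m) + n) + s"
        by (simp add: cp power_add)
      also have "[\<dots> = - s * 1 + s] (mod p)"
        by (intro cong_add cong_mult one cong_refl)
      finally show ?thesis by (simp add: cong_0_iff)
    qed
    then show ?thesis using \<open>p \<in> P\<close> by blast
  qed
  then show ?thesis by blast
qed

lemma finite_associated_primes:
  assumes "covering_system C" "associated_primes b C P"
  shows "finite P"
proof -
  obtain \<pi> where "bij_betw \<pi> C P" using assms(2) unfolding associated_primes_def by blast
  moreover have "finite C" using assms(1) unfolding covering_system_def by blast
  ultimately show ?thesis by (simp add: bij_betw_finite)
qed

lemma composite_if_prime_dvd:
  assumes "prime p" "p dvd x" "p < x"
  shows "composite x"
proof -
  have "p > 1" using assms(1) prime_gt_1_int by blast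
  moreover have "\<not> prime x"
    using assms \<open>p > 1\<close> by (metis less_irrefl primes_dvd_imp_eq)
  ultimately show ?thesis
    using assms(3) by (simp add: composite_def)
qed

lemma associated_primeE:
  assumes "associated_primes b C P" "one_congruence_per_modulus C S" "p \<in> P"
  obtains m where "m \<in> S" "primitive_prime_divisor b m p"
proof -
  obtain \<pi> where "bij_betw \<pi> C P" "\<And>r m. (r, m) \<in> C \<Longrightarrow> primitive_prime_divisor b m (\<pi> (r, m))"
    using assms(1) unfolding associated_primes_def by blast
  then obtain r m where "(r, m) \<in> C" "primitive_prime_divisor b m p"
    using assms(3) by (auto simp: bij_betw_def)
  moreover have "m \<in> S"
    using assms(2) calculation(1) by (force simp: one_congruence_per_modulus_def bij_betw_def)
  ultimately show thesis using that by blast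
qed

text \<open>Both exponents are the multiplicative order of \<open>b\<close> modulo \<open>p\<close>.
  Hence systems without a common modulus have disjoint sets of primes.\<close>

lemma primitive_prime_divisor_order_unique:
  assumes "primitive_prime_divisor b m p" "primitive_prime_divisor b m' p"
  shows "m = m'"
  using assms unfolding primitive_prime_divisor_def by (meson linorder_neqE_nat)

text \<open>For \<open>m > 1\<close> the exponent 1 is among those excluded by primitivity. Since
  one of \<open>b\<close> and \<open>b - 1\<close> is even, \<open>p\<close> cannot be 2.\<close>

lemma primitive_prime_divisor_not_dvd:
  assumes "primitive_prime_divisor b m p" "m > 1"
  shows "\<not> p dvd b" "\<not> p dvd b - 1" "p \<ge> 3"
proof -
  have p: "prime p" "p dvd b ^ m - 1" and "\<not> p dvd b ^ 1 - 1"
    using assms unfolding primitive_prime_divisor_def by (blast, blast, metis le_refl)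
  then show b1: "\<not> p dvd b - 1" by simp
  show b: "\<not> p dvd b"
  proof
    assume "p dvd b"
    then have "p dvd b ^ m" using assms(2) by (simp add: dvd_power_le dvd_trans[OF _ dvd_power])
    then have "p dvd b ^ m - (b ^ m - 1)" using p(2) by (rule dvd_diff)
    then have "p dvd 1" by simp
    then show False using p(1) not_prime_unit by blast
  qed
  have "p \<noteq> 2" using b b1 by auto
  then show "p \<ge> 3" using prime_ge_2_int[OF p(1)] by linarith
qed

section \<open>Size estimates and the criterion for Brier numbers\<close>

lemma mult_power_strict_mono:
  fixes b :: int
  assumes "b \<ge> 1"
  shows "strict_mono (\<lambda>t::nat. int t * b ^ t)"
proof (rule strict_mono_Suc_iff[THEN iffD2], rule allI)
  fix t :: nat
  have "int t * b ^ t < int (Suc t) * b ^ t" using assms by simp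
  also have "\<dots> \<le> int (Suc t) * b ^ Suc t"
    using assms by (intro mult_left_mono power_increasing) auto
  finally show "int t * b ^ t < int (Suc t) * b ^ Suc t" .
qed


text \<open>A prime dividing both \<open>b - 1\<close> and k + 1 or k - 1 would also divide
  \<open>k\<close>, hence 1. The bound \<open>big\<close> puts \<open>k * b - 1\<close>, and with it
  all larger terms, above every prime of \<open>P\<close>, so the divisors found are proper.\<close>

lemma brier_of_prime_divisors:
  fixes b k X :: int
  assumes "b \<ge> 3" and k: "\<And>r. prime r \<Longrightarrow> r dvd b - 1 \<Longrightarrow> r dvd k"
    and P: "\<And>p. p \<in> P \<Longrightarrow> prime p \<and> p \<le> X"
    and "X \<ge> 0" and big: "X + 1 < k * b"
    and plus: "\<And>n. \<exists>p\<in>P. p dvd k * b ^ n + 1"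
    and minus: "\<And>n. \<exists>p\<in>P. p dvd k * b ^ n - 1"
  shows "brier b k"
proof -
  have "k > 0" using big \<open>X \<ge> 0\<close> \<open>b \<ge> 3\<close> by (smt (verit) mult_nonpos_nonneg)
  have "coprime (k + e) (b - 1)" if e: "e = 1 \<or> e = -1" for e :: int
  proof (rule ccontr)
    assume "\<not> coprime (k + e) (b - 1)"
    then have "\<not> is_unit (gcd (k + e) (b - 1))" by (simp add: coprime_iff_gcd_eq_1)
    moreover have "gcd (k + e) (b - 1) \<noteq> 0" using \<open>b \<ge> 3\<close> by simp
    ultimately obtain r where r: "prime r" "r dvd k + e" "r dvd b - 1"
      using prime_divisor_exists by (metis gcd_greatest_iff)
    then have "r dvd k + e - k" using k by (intro dvd_diff) auto
    then show False using r(1) e not_prime_unit by fastforce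
  qed
  from this[of 1] this[of "-1"]
  have "gcd (k + 1) (b - 1) = 1" "gcd (k - 1) (b - 1) = 1"
    by (simp_all add: coprime_iff_gcd_eq_1)
  moreover have "composite (k * b ^ n + 1) \<and> composite (k * b ^ n - 1)" if "n > 0" for n
  proof -
    have "b ^ 1 \<le> b ^ n" using that \<open>b \<ge> 3\<close> by (intro power_increasing) auto
    then have "k * b \<le> k * b ^ n" using \<open>k > 0\<close> by simp
    then have "X < k * b ^ n - 1" using big by simp
    moreover obtain p p' where "p \<in> P" "p dvd k * b ^ n + 1" "p' \<in> P" "p' dvd k * b ^ n - 1"
      using plus minus by blast
    ultimately show ?thesis
      using P[of p] P[of p']
      by (intro conjI composite_if_prime_dvd[of p] composite_if_prime_dvd[of p']) auto
  qed
  ultimately show ?thesis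
    using \<open>k > 0\<close> by (simp add: brier_def sierpinski_def riesel_def)
qed

section \<open>Choice of the residue class modulo \<open>M\<close>\<close>

theorem theorem3p5:
  fixes b \<alpha> M :: int and q :: nat
    and C1 C2 :: "congruence set" and P1 P2 :: "int set"
  assumes "b \<ge> 3"
    and "\<not> (\<exists>k::nat. b + 1 = 2 ^ k)"
    and "\<alpha> \<noteq> 0"
    and "prime q" and "q \<ge> 5"
    and "primitive_covering_system b C1"
    and "one_congruence_per_modulus C1
           ({2 ^ j | j. 1 \<le> j \<and> j \<le> q} \<union> {2 ^ j * q | j. 0 \<le> j \<and> j \<le> q})"
    and "primitive_covering_system b C2"
    and "one_congruence_per_modulus C2
           {2 ^ j * 3 ^ i * q ^ j' | j i j'. 0 \<le> j \<and> j \<le> q \<and> 1 \<le> i \<and> i \<le> q \<and> 0 \<le> j' \<and> j' \<le> 1}"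
    and "associated_primes b C1 P1"
    and "associated_primes b C2 P2"
    and "M = Lcm ({2 ^ q, 3 ^ q, b - 1, int q} \<union> P1 \<union> P2)"
  shows "\<exists>T::int. \<forall>t::nat. [int t = T] (mod M) \<longrightarrow>
           (int t * b ^ t + \<alpha>) * b + 1 \<ge> Max (P1 \<union> P2) \<longrightarrow>
           brier b (int t * b ^ t + \<alpha>)"
proof -
  define S1 where "S1 = {2 ^ j | j. 1 \<le> j \<and> j \<le> q} \<union> {2 ^ j * q | j. 0 \<le> j \<and> j \<le> q}"
  define S2 where "S2 = {2 ^ j * 3 ^ i * q ^ j' | j i j'. 0 \<le> j \<and> j \<le> q \<and> 1 \<le> i \<and> i \<le> q \<and> 0 \<le> j' \<and> j' \<le> 1}"
  define P where "P = P1 \<union> P2"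
  define X where "X = Max P"
  have cov: "covering_system C1" "covering_system C2"
    using assms(6,8) by (auto simp: primitive_covering_system_def)
  have "finite P"
    using finite_associated_primes cov assms(10,11) unfolding P_def by blast
  have primes_1: "\<exists>m\<in>S1. primitive_prime_divisor b m p" if "p \<in> P1" for p
    using associated_primeE[OF assms(10) assms(7)[folded S1_def] that] by blast
  have primes_2: "\<exists>m\<in>S2. primitive_prime_divisor b m p" if "p \<in> P2" for p
    using associated_primeE[OF assms(11) assms(9)[folded S2_def] that] by blast

  \<comment> \<open>The orders belonging to \<open>P1\<close> are prime to 3, those belonging to
    \<open>P2\<close> are multiples of 3. So the two sets are disjoint and their residue conditions
    cannot conflict.\<close>
  have coprime_q: "coprime 3 q" "coprime 2 q"
    using assms(4,5) primes_coprime[of 3 q] primes_coprime[of 2 q] by simp_all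
  have "\<not> 3 dvd m" if "m \<in> S1" for m
  proof -
    have "coprime 3 m" using that coprime_q unfolding S1_def by auto
    then show ?thesis by auto
  qed
  moreover have three_dvd: "3 dvd m" if m: "m \<in> S2" for m
  proof -
    obtain j i j' where "m = 2 ^ j * 3 ^ i * q ^ j'" "1 \<le> i"
      using m unfolding S2_def by blast
    then show ?thesis by (simp add: dvd_mult dvd_mult2 dvd_power)
  qed
  ultimately have disjoint: "P1 \<inter> P2 = {}"
    using primes_1 primes_2 primitive_prime_divisor_order_unique by blast

  \<comment> \<open>As \<open>q \<ge> 5\<close>, the three factors are pairwise coprime. Every
    modulus divides their product, so \<open>b ^ t\<close> modulo a prime of \<open>P\<close>
    depends only on \<open>t\<close> modulo \<open>M\<close>.\<close>
  have M_dvd: "2 ^ q * 3 ^ q * int q dvd M"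
  proof -
    have "2 ^ q dvd M" "3 ^ q dvd M" "int q dvd M"
      unfolding assms(12) by (auto intro!: dvd_Lcm)
    moreover have "coprime (int q) 2" "coprime (int q) 3"
      using coprime_q coprime_int_iff[of q 2] coprime_int_iff[of q 3] by (auto simp: coprime_commute)
    ultimately show ?thesis by (simp add: divides_mult coprime_commute)
  qed
  have moduli_dvd_nat: "m dvd 2 ^ q * 3 ^ q * q" if m: "m \<in> S1 \<union> S2" for m
  proof -
    consider j where "m = 2 ^ j" "j \<le> q" | j where "m = 2 ^ j * q" "j \<le> q"
      | j i j' where "m = 2 ^ j * 3 ^ i * q ^ j'" "j \<le> q" "i \<le> q" "j' \<le> 1"
      using m unfolding S1_def S2_def by blast
    then show ?thesis
    proof cases
      case 1
      then show ?thesis by (simp add: le_imp_power_dvd dvd_mult2)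
    next
      case 2
      then show ?thesis by (auto intro!: mult_dvd_mono dvd_mult2 le_imp_power_dvd)
    next
      case 3
      then show ?thesis
        using le_imp_power_dvd[of j' 1 q] by (auto intro!: mult_dvd_mono le_imp_power_dvd)
    qed
  qed
  have moduli_dvd: "int m dvd M" if "m \<in> S1 \<union> S2" for m
  proof -
    have "int m dvd int (2 ^ q * 3 ^ q * q)"
      unfolding int_dvd_int_iff using that by (rule moduli_dvd_nat)
    then have "int m dvd 2 ^ q * 3 ^ q * int q" by simp
    then show ?thesis using M_dvd by (rule dvd_trans)
  qed
  \<comment> \<open>Modulus 1 would give a prime divisor of \<open>b - 1\<close>, where the residue
    of \<open>T\<close> is already prescribed.\<close>
  have moduli_gt_1: "m > 1" if m: "m \<in> S1 \<union> S2" for m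
  proof -
    have "m \<noteq> 0"
      using moduli_dvd_nat[OF m] assms(5) by (intro notI) simp
    moreover have "m \<noteq> 1"
    proof (cases "m \<in> S2")
      case True
      then show ?thesis using three_dvd by fastforce
    next
      case False
      then consider j where "m = 2 ^ j" "1 \<le> j" | j where "m = 2 ^ j * q"
        using m unfolding S1_def by blast
      then show ?thesis using assms(5) by cases auto
    qed
    ultimately show ?thesis by simp
  qed
  have P: "prime p" "\<not> p dvd b" "\<not> p dvd b - 1" "p \<ge> 3" "p dvd M"
    "\<exists>m. [b ^ m = 1] (mod p) \<and> int m dvd M" if p: "p \<in> P" for p
  proof -
    obtain m where m: "m \<in> S1 \<union> S2" "primitive_prime_divisor b m p"
      using primes_1 primes_2 p unfolding P_def by blast
    show "\<not> p dvd b" "\<not> p dvd b - 1" "p \<ge> 3"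
      using primitive_prime_divisor_not_dvd[OF m(2) moduli_gt_1[OF m(1)]] by blast+
    show "prime p" "\<exists>m. [b ^ m = 1] (mod p) \<and> int m dvd M"
      using m(2) moduli_dvd[OF m(1)] by (auto simp: primitive_prime_divisor_def cong_iff_dvd_diff)
    show "p dvd M" using p unfolding assms(12) P_def by (intro dvd_Lcm) auto
  qed

  \<comment> \<open>With \<open>o'\<close> the odd part of \<open>b - 1\<close>, every prime divisor
    of \<open>b - 1\<close> divides \<open>2 * o'\<close>. A class modulo \<open>2 * o'\<close>
    splits into two classes modulo \<open>4 * o'\<close>, which differ modulo 4; these supply the
    two choices of \<open>T\<close>.\<close>
  obtain o' where o': "b - 1 = 2 ^ multiplicity 2 (b - 1) * o'" "\<not> 2 dvd o'"
    using multiplicity_decompose'[of "b - 1" 2] assms(1) by auto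
  have o_pos: "o' > 0"
    using o'(1) assms(1) by (smt (verit) mult_nonneg_nonpos zero_le_power)
  have "4 dvd M"
  proof -
    have "(2::int) ^ 2 dvd 2 ^ q" using assms(5) by (intro le_imp_power_dvd) auto
    moreover have "2 ^ q dvd M" unfolding assms(12) by (intro dvd_Lcm) auto
    ultimately show ?thesis using dvd_trans by fastforce
  qed
  have "2 * o' dvd M"
  proof -
    have "o' dvd b - 1" by (subst o'(1)) simp
    moreover have "b - 1 dvd M" unfolding assms(12) by (intro dvd_Lcm) auto
    ultimately have "o' dvd M" by (rule dvd_trans)
    moreover have "2 dvd M" using \<open>4 dvd M\<close> by presburger
    moreover have "coprime 2 o'" using o'(2) by (simp add: prime_imp_coprime)
    ultimately show ?thesis by (intro divides_mult)
  qed

  obtain c1 where c1: "\<And>n. \<exists>p\<in>P1. \<forall>k. [k = c1 p] (mod p) \<longrightarrow> p dvd k * b ^ n + 1"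
    using covering_residues[OF cov(1) assms(10)] by blast
  obtain c2 where c2: "\<And>n. \<exists>p\<in>P2. \<forall>k. [k = c2 p] (mod p) \<longrightarrow> p dvd k * b ^ n - 1"
    using covering_residues[OF cov(2) assms(11), of "-1"] by auto
  define c where "c p = (if p \<in> P1 then c1 p else c2 p)" for p
  have not_dvd: "\<not> p dvd 4 * o'" if "p \<in> P" for p
  proof
    assume "p dvd 4 * o'"
    moreover have "\<not> p dvd 4"
    proof
      assume "p dvd 4"
      then have "p dvd 2 ^ 2" by simp
      then have "p dvd 2" using P(1)[OF that] prime_dvd_power by blast
      then show False using P(4)[OF that] zdvd_imp_le by fastforce
    qed
    moreover have "\<not> p dvd o'" using P(3)[OF that] o'(1) by (metis dvd_mult)
    ultimately show False using P(1)[OF that] by (simp add: prime_dvd_mult_iff)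
  qed
  \<comment> \<open>The target is shifted by \<open>\<alpha>\<close> so that
    \<open>int t * b ^ t + \<alpha>\<close> gets the residue \<open>c p\<close>.\<close>
  have residue: "\<exists>T::nat. [int T = a] (mod 4 * o') \<and>
      (\<forall>p\<in>P. [int T * b ^ T = c p - \<alpha>] (mod p))" for a
    using o_pos P not_dvd by (intro exists_mult_power_residues \<open>finite P\<close>) auto

  \<comment> \<open>The condition is imposed modulo \<open>2 * o'\<close> rather than
    \<open>4 * o'\<close>, so that it covers both choices of \<open>T\<close>.\<close>
  have brier: "brier b (int t * b ^ t + \<alpha>)"
    if t: "[int t = int T] (mod M)" and T: "[int T = - \<alpha>] (mod 2 * o')"
      "\<forall>p\<in>P. [int T * b ^ T = c p - \<alpha>] (mod p)"
      and big: "X + 1 < (int t * b ^ t + \<alpha>) * b" for t T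
  proof -
    let ?k = "int t * b ^ t + \<alpha>"
    have k: "[?k = c p] (mod p)" if "p \<in> P" for p
    proof -
      obtain m where m: "[b ^ m = 1] (mod p)" "int m dvd M" using P(6)[OF \<open>p \<in> P\<close>] by blast
      have "[b ^ t = b ^ T] (mod p)"
        using cong_pow_of_cong_exponent[OF m(1)] cong_dvd_modulus[OF t m(2)] by blast
      then have "[int t * b ^ t = int T * b ^ T] (mod p)"
        by (rule cong_mult[OF cong_dvd_modulus[OF t P(5)[OF \<open>p \<in> P\<close>]]])
      also have "[int T * b ^ T = c p - \<alpha>] (mod p)" using T(2) \<open>p \<in> P\<close> by blast
      finally show ?thesis by (simp add: cong_iff_dvd_diff algebra_simps)
    qed
    have "r dvd ?k" if r: "prime r" "r dvd b - 1" for r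
    proof -
      have "r dvd 2 * o'"
        using r o'(1) by (metis dvd_mult dvd_mult2 prime_dvd_mult_iff prime_dvd_power)
      then have "[int t = - \<alpha>] (mod r)"
        using cong_dvd_modulus[OF t \<open>2 * o' dvd M\<close>] T(1) by (meson cong_dvd_modulus cong_trans)
      \<comment> \<open>Since \<open>b\<close> is 1 modulo \<open>r\<close>, the number reduces to
        \<open>t + \<alpha>\<close>, which vanishes there.\<close>
      moreover have "[b ^ t = 1 ^ t] (mod r)"
        using r(2) by (intro cong_pow) (simp add: cong_iff_dvd_diff)
      ultimately have "[?k = - \<alpha> * 1 ^ t + \<alpha>] (mod r)" by (intro cong_add cong_mult cong_refl)
      then show ?thesis by (simp add: cong_0_iff)
    qed
    moreover have "p \<le> X" if "p \<in> P" for p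
      using Max_ge[OF \<open>finite P\<close> that] by (simp add: X_def)
    moreover have "\<exists>p\<in>P. p dvd ?k * b ^ n + 1" for n
    proof -
      obtain p where p: "p \<in> P1" "[?k = c1 p] (mod p) \<longrightarrow> p dvd ?k * b ^ n + 1"
        using c1 by blast
      then show ?thesis using k[of p] unfolding P_def c_def by auto
    qed
    moreover have "\<exists>p\<in>P. p dvd ?k * b ^ n - 1" for n
    proof -
      obtain p where p: "p \<in> P2" "[?k = c2 p] (mod p) \<longrightarrow> p dvd ?k * b ^ n - 1"
        using c2 by blast
      then have "p \<notin> P1" using disjoint by blast
      then show ?thesis using p k[of p] unfolding P_def c_def by auto
    qed
    moreover have "X \<ge> 0"
    proof -
      obtain p where "p \<in> P" using c1 unfolding P_def by blast
      then have "3 \<le> p" "p \<le> X" using P(4) \<open>finite P\<close> by (auto simp: X_def)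
      then show ?thesis by simp
    qed
    ultimately show ?thesis
      using brier_of_prime_divisors[OF assms(1), of ?k P X] P(1) big by blast
  qed

  obtain T1 where T1: "[int T1 = - \<alpha>] (mod 4 * o')"
    "\<forall>p\<in>P. [int T1 * b ^ T1 = c p - \<alpha>] (mod p)"
    using residue by blast
  obtain T2 where T2: "[int T2 = - \<alpha> + 2 * o'] (mod 4 * o')"
    "\<forall>p\<in>P. [int T2 * b ^ T2 = c p - \<alpha>] (mod p)"
    using residue by blast
  have incong: "\<not> [int T1 = int T2] (mod M)"
  proof
    assume "[int T1 = int T2] (mod M)"
    then have "[int T1 = int T2] (mod 4)" using \<open>4 dvd M\<close> by (rule cong_dvd_modulus)
    moreover have "[int T1 = - \<alpha>] (mod 4)" "[int T2 = - \<alpha> + 2 * o'] (mod 4)"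
      using T1(1) T2(1) by (auto intro: cong_modulus_mult)
    ultimately have "[- \<alpha> + 2 * o' = - \<alpha>] (mod 4)" by (metis cong_sym cong_trans)
    then have "4 dvd 2 * o'" by (simp add: cong_iff_dvd_diff)
    then show False using o'(2) by presburger
  qed
  have T1': "[int T1 = - \<alpha>] (mod 2 * o')"
    by (rule cong_dvd_modulus[OF T1(1)]) auto
  have "[int T2 = - \<alpha> + 2 * o'] (mod 2 * o')"
    by (rule cong_dvd_modulus[OF T2(1)]) auto
  then have T2': "[int T2 = - \<alpha>] (mod 2 * o')"
    by (simp add: cong_def)

  \<comment> \<open>The \<open>t\<close> that meet the size hypothesis of the theorem but not the
    strict bound \<open>big\<close>: for them \<open>(int t * b ^ t + \<alpha>) * b\<close> lies
    between \<open>X - 1\<close> and \<open>X + 1\<close>.\<close>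
  define exceptional where "exceptional t \<longleftrightarrow>
    X \<le> (int t * b ^ t + \<alpha>) * b + 1 \<and> (int t * b ^ t + \<alpha>) * b \<le> X + 1" for t
  have unique: "t = t'" if "exceptional t" "exceptional t'" for t t'
  proof -
    \<comment> \<open>Two multiples of \<open>b\<close> in a window of width 2 coincide because
      \<open>b \<ge> 3\<close>; monotonicity of t b^t then gives equality of the indices.\<close>
    have "\<bar>((int t * b ^ t + \<alpha>) - (int t' * b ^ t' + \<alpha>)) * b\<bar> < b"
      using that assms(1) unfolding exceptional_def left_diff_distrib by linarith
    then have "(int t * b ^ t + \<alpha>) - (int t' * b ^ t' + \<alpha>) = 0"
      using assms(1) by (auto simp: abs_mult)
    then show ?thesis
      using strict_mono_eq[OF mult_power_strict_mono[of b]] assms(1) by simp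
  qed
  have good: ?thesis
    if "[int T = - \<alpha>] (mod 2 * o')" "\<forall>p\<in>P. [int T * b ^ T = c p - \<alpha>] (mod p)"
      "\<And>t. [int t = int T] (mod M) \<Longrightarrow> \<not> exceptional t" for T
    using brier[OF _ that(1,2)] that(3) unfolding exceptional_def X_def P_def
    by (intro exI[of _ "int T"]) force
  show ?thesis
  \<comment> \<open>If the class of \<open>T1\<close> contains the only possible exceptional
    \<open>t\<close>, the class of \<open>T2\<close>, being different modulo \<open>M\<close>,
    contains none.\<close>
  proof (cases "\<exists>t. [int t = int T1] (mod M) \<and> exceptional t")
    case True
    then have "\<not> exceptional t" if "[int t = int T2] (mod M)" for t
      using that incong unique by (metis cong_sym cong_trans)
    then show ?thesis by (rule good[OF T2' T2(2)])
  next
    case False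
    then show ?thesis using good[OF T1' T1(2)] by blast
  qed
qed

end
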